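(* Suppose that the cost functions $C_t$, $1\le t\le T$, are convex. Then there always exists a pair $(S^*,\mu^* )$, with $S^*=(S^*_0,\dots,S^*_T)\in\mathbb{R}^{T+1}$ and $\mu^*=(\mu^*_1,\dots,\mu^*_T)\in\mathbb{R}^T$, such that $S^*$ solves problem $\mathbf{P}$ and (i) $S^*$ is feasible for problem $\mathbf{P}$; (ii) for each $t$ with $1\le t\le T$, $x_t(S^* )$ minimises $C_t(x)-\mu^*_t x$ over $x\in X$; (iii) for each $t$ with $1\le t\le T-1$, \[ \begin{cases}\rho\mu^*_{t+1}=\mu^*_t & \text{if } 0<S^*_t<E,\\ \rho\mu^*_{t+1}\le\mu^*_t & \text{if } S^*_t=0,\\ \rho\mu^*_{t+1}\ge\mu^*_t & \text{if } S^*_t=E.\end{cases} \]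
   Context: Data: an integer $T\ge1$; a capacity $E>0$; rate constraints $P_i>0$ (input) and $P_o>0$ (output); a leakage parameter $\rho$ with $0<\rho\le1$; $X=\{x\in\mathbb{R}:-P_o\le x\le P_i\}$; cost functions $C_t:\mathbb{R}\to\mathbb{R}$ for $1\le t\le T$ (real-valued on the whole real line); fixed real numbers $S^*_0$ and $S^*_T$ (the prescribed initial and final store levels). For $S=(S_0,\dots,S_T)\in\mathbb{R}^{T+1}$ put $x_t(S)=S_t-\rho S_{t-1}$, $1\le t\le T$. Problem $\mathbf{P}$: choose $S$ so as to minimise \[G(S)=\sum_{t=1}^T C_t(x_t(S))\] subject to the capacity constraints $S_0=S^*_0$, $S_T=S^*_T$, $0\le S_t\le E$ for $1\le t\le T-1$, and the rate constraints $x_t(S)\in X$ for $1\le t\le T$. A vector $S$ is called feasible if it satisfies both the capacity and the rate constraints; $S$ solves $\mathbf{P}$ if it is feasible and minimises $G$ among feasible vectors. It is assumed that the set of feasible vectors is nonempty. *)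

theory Defs
  imports "HOL-Analysis.Analysis"
begin

text \<open>
  Vectors \<open>(S\<^sub>0, \<dots>, S\<^sub>T)\<close> and \<open>(\<mu>\<^sub>1, \<dots>, \<mu>\<^sub>T)\<close>, and the family \<open>(C\<^sub>1, \<dots>, C\<^sub>T)\<close>, are represented
  by functions on \<^typ>\<open>nat\<close>.  All notions below only read the entries at indices \<open>0..T\<close>
  (resp. \<open>1..T\<close>), so values outside this range are irrelevant.
\<close>

text \<open>The amount \<open>x\<^sub>t(S)\<close>; it is only used for \<open>t \<ge> 1\<close>, where the subtraction does not truncate.\<close>

definition increment :: "real \<Rightarrow> (nat \<Rightarrow> real) \<Rightarrow> nat \<Rightarrow> real" where
  "increment \<rho> S t = S t - \<rho> * S (t - 1)"

definition rate_set :: "real \<Rightarrow> real \<Rightarrow> real set" where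
  "rate_set P_in P_out = {x. - P_out \<le> x \<and> x \<le> P_in}"

definition total_cost :: "nat \<Rightarrow> real \<Rightarrow> (nat \<Rightarrow> real \<Rightarrow> real) \<Rightarrow> (nat \<Rightarrow> real) \<Rightarrow> real" where
  "total_cost T \<rho> C S = (\<Sum>t = 1..T. C t (increment \<rho> S t))"

definition capacity_constraints ::
  "nat \<Rightarrow> real \<Rightarrow> real \<Rightarrow> real \<Rightarrow> (nat \<Rightarrow> real) \<Rightarrow> bool" where
  "capacity_constraints T E S_init S_final S \<longleftrightarrow>
     S 0 = S_init \<and> S T = S_final \<and> (\<forall>t. 1 \<le> t \<and> t \<le> T - 1 \<longrightarrow> 0 \<le> S t \<and> S t \<le> E)"

definition rate_constraints ::
  "nat \<Rightarrow> real \<Rightarrow> real \<Rightarrow> real \<Rightarrow> (nat \<Rightarrow> real) \<Rightarrow> bool" where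
  "rate_constraints T P_in P_out \<rho> S \<longleftrightarrow>
     (\<forall>t. 1 \<le> t \<and> t \<le> T \<longrightarrow> increment \<rho> S t \<in> rate_set P_in P_out)"

definition feasible ::
  "nat \<Rightarrow> real \<Rightarrow> real \<Rightarrow> real \<Rightarrow> real \<Rightarrow> real \<Rightarrow> real \<Rightarrow> (nat \<Rightarrow> real) \<Rightarrow> bool" where
  "feasible T E P_in P_out \<rho> S_init S_final S \<longleftrightarrow>
     capacity_constraints T E S_init S_final S \<and> rate_constraints T P_in P_out \<rho> S"

definition solves_P ::
  "nat \<Rightarrow> real \<Rightarrow> real \<Rightarrow> real \<Rightarrow> real \<Rightarrow> real \<Rightarrow> real \<Rightarrow> (nat \<Rightarrow> real \<Rightarrow> real) \<Rightarrow> (nat \<Rightarrow> real) \<Rightarrow> bool" where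
  "solves_P T E P_in P_out \<rho> S_init S_final C S \<longleftrightarrow>
     is_arg_min (total_cost T \<rho> C) (feasible T E P_in P_out \<rho> S_init S_final) S"

end

theory Submission
  imports Defs
begin

text \<open>
  The proof finds an optimal \<open>S\<close> by compactness and then reads the multipliers off its optimality,
  without any constraint qualification.

  Put \<open>p\<^sub>t = \<rho>\<^sup>t \<mu>\<^sub>t\<close>. Condition (iii) then says only how \<open>p\<^sub>t\<close> and \<open>p\<^sub>t\<^sub>+\<^sub>1\<close> are ordered: \<open>p\<^sub>t \<le> p\<^sub>t\<^sub>+\<^sub>1\<close>
  if \<open>S\<^sub>t > 0\<close>, and \<open>p\<^sub>t\<^sub>+\<^sub>1 \<le> p\<^sub>t\<close> if \<open>S\<^sub>t < E\<close>. Chaining these gives a preorder on the times, called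
  \<open>price_order\<close> below. Condition (ii) says that \<open>\<mu>\<^sub>t\<close> lies above the slopes of all chords of \<open>C\<^sub>t\<close> that
  end at \<open>x\<^sub>t(S)\<close> and start in \<open>X\<close> to the left of it, and below the slopes of all chords that go from
  \<open>x\<^sub>t(S)\<close> to a point of \<open>X\<close> on its right. So \<open>p\<close> has to be a monotone function on a finite preorder
  that respects given lower and upper bounds at each point. Such a function exists as soon as no lower
  bound at \<open>s\<close> exceeds an upper bound at some \<open>t\<close> above \<open>s\<close> (\<open>monotone_selection\<close>): take at each \<open>t\<close>
  the supremum of the lower bounds at all \<open>s\<close> below \<open>t\<close>.

  This compatibility of bounds is what optimality gives (\<open>left_chord_le_right_chord\<close>). If \<open>s\<close> is below
  \<open>t\<close> in the preorder, then the store has room to shift a small input from time \<open>s\<close> to time \<open>t\<close>: for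
  \<open>s < t\<close> this lowers only levels \<open>S\<^sub>u > 0\<close>, for \<open>t < s\<close> it raises only levels \<open>S\<^sub>u < E\<close>. If a left chord
  at \<open>s\<close> were steeper than a right chord at \<open>t\<close>, the shift would save money, by convexity.

  Chord slopes take the place of one-sided derivatives, so that the end points of \<open>X\<close> need no separate
  treatment: there one of the two families of chords is empty. Convexity of \<open>C\<^sub>t\<close> on the whole line,
  beyond \<open>X\<close>, keeps the other family bounded.
\<close>

section \<open>Existence of an optimal store path\<close>

lemma feasible_truncate:
  assumes "feasible T E P_in P_out \<rho> S_init S_final S"
  defines "S' \<equiv> \<lambda>u. if u \<le> T then S u else 0"
  shows "feasible T E P_in P_out \<rho> S_init S_final S'" and "total_cost T \<rho> C S' = total_cost T \<rho> C S"
proof -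
  have inc: "increment \<rho> S' t = increment \<rho> S t" if "t \<le> T" for t
    using that by (simp add: increment_def S'_def)
  show "feasible T E P_in P_out \<rho> S_init S_final S'"
    using assms(1) inc
    by (auto simp: feasible_def capacity_constraints_def rate_constraints_def S'_def)
  show "total_cost T \<rho> C S' = total_cost T \<rho> C S"
    using inc by (simp add: total_cost_def)
qed

text \<open>
  The entries of \<open>S\<close> after time \<open>T\<close> are free, so the feasible paths themselves are not a compact subset
  of the product space; those that vanish after time \<open>T\<close> are, and they attain all feasible costs.
\<close>

lemma solves_P_exists:
  assumes "T \<ge> 1"
    and feas: "\<exists>S. feasible T E P_in P_out \<rho> S_init S_final S"
    and cont: "\<And>t. 1 \<le> t \<Longrightarrow> t \<le> T \<Longrightarrow> continuous_on UNIV (C t)"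
  shows "\<exists>S. solves_P T E P_in P_out \<rho> S_init S_final C S"
proof -
  define b where "b u = (if u = 0 then {S_init} else if u = T then {S_final}
    else if u < T then {0..E} else {0})" for u
  define R where "R = {S. \<forall>t\<in>{1..T}. - P_out \<le> increment \<rho> S t \<and> increment \<rho> S t \<le> P_in}"
  define K where "K = PiE UNIV b \<inter> R"
  have coord: "continuous_on UNIV (\<lambda>S::nat \<Rightarrow> real. S i)" for i
    by (rule continuous_on_product_then_coordinatewise) (rule continuous_on_id)
  have inc: "continuous_on UNIV (\<lambda>S. increment \<rho> S t)" for t
    unfolding increment_def by (intro continuous_intros coord)
  have "compact (PiE UNIV b)"
  proof -
    have "compactin (product_topology (\<lambda>_. euclidean) UNIV) (PiE UNIV b)"
      unfolding compactin_PiE by (auto simp: b_def)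
    then show ?thesis by (simp add: euclidean_product_topology)
  qed
  moreover have "closed R"
  proof -
    have "R = (\<Inter>t\<in>{1..T}. {S. - P_out \<le> increment \<rho> S t} \<inter> {S. increment \<rho> S t \<le> P_in})"
      by (auto simp: R_def)
    then show ?thesis
      by (auto intro!: closed_INT closed_Int closed_Collect_le inc continuous_on_const)
  qed
  ultimately have "compact K"
    unfolding K_def by (rule compact_Int_closed)
  have cost: "continuous_on K (total_cost T \<rho> C)"
  proof -
    have "continuous_on K (\<lambda>S. C t (increment \<rho> S t))" if "t \<in> {1..T}" for t
      by (rule continuous_on_compose2[OF cont]) (use that inc in \<open>auto intro: continuous_on_subset\<close>)
    then show ?thesis unfolding total_cost_def by (intro continuous_on_sum)
  qed
  have K_feas: "feasible T E P_in P_out \<rho> S_init S_final S" if "S \<in> K" for S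
  proof -
    have S: "S u \<in> b u" for u using that by (auto simp: K_def)
    have "S 0 = S_init" "S T = S_final" using S[of 0] S[of T] \<open>T \<ge> 1\<close> by (auto simp: b_def)
    moreover have "0 \<le> S u \<and> S u \<le> E" if "1 \<le> u" "u \<le> T - 1" for u
      using S[of u] that \<open>T \<ge> 1\<close> by (simp add: b_def split: if_splits)
    moreover have "rate_constraints T P_in P_out \<rho> S"
      using that by (simp add: K_def R_def rate_constraints_def rate_set_def)
    ultimately show ?thesis
      by (simp add: feasible_def capacity_constraints_def)
  qed
  have feas_K: "(\<lambda>u. if u \<le> T then S u else 0) \<in> K" (is "?S' \<in> K")
    if "feasible T E P_in P_out \<rho> S_init S_final S" for S
  proof -
    have "feasible T E P_in P_out \<rho> S_init S_final ?S'"
      using that by (rule feasible_truncate)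
    then have cap: "capacity_constraints T E S_init S_final ?S'"
      and rate: "rate_constraints T P_in P_out \<rho> ?S'"
      by (simp_all only: feasible_def)
    have "?S' u \<in> b u" for u
    proof (cases "1 \<le> u \<and> u \<le> T - 1")
      case True
      then have "0 \<le> ?S' u \<and> ?S' u \<le> E"
        using cap unfolding capacity_constraints_def by blast
      then show ?thesis using True by (auto simp: b_def)
    next
      case False
      then have "u = 0 \<or> u = T \<or> T < u" by linarith
      then show ?thesis using cap by (auto simp: b_def capacity_constraints_def)
    qed
    moreover have "?S' \<in> R"
      using rate unfolding rate_constraints_def rate_set_def R_def by simp
    ultimately show ?thesis by (simp add: K_def PiE_UNIV_domain Pi_def)
  qed
  have "K \<noteq> {}" using feas feas_K by blast
  then obtain S where "S \<in> K" and min: "\<forall>S'\<in>K. total_cost T \<rho> C S \<le> total_cost T \<rho> C S'"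
    using continuous_attains_inf[OF \<open>compact K\<close> _ cost] by blast
  have "total_cost T \<rho> C S \<le> total_cost T \<rho> C S'"
    if "feasible T E P_in P_out \<rho> S_init S_final S'" for S'
    using min feas_K[OF that] feasible_truncate(2)[OF that, of C] by metis
  with K_feas[OF \<open>S \<in> K\<close>] show ?thesis
    unfolding solves_P_def is_arg_min_linorder by blast
qed

section \<open>Monotone functions between bounds on a finite preorder\<close>

text \<open>
  The supremum of the lower bounds at points below \<open>t\<close> is monotone in \<open>t\<close> by transitivity, and at most
  every upper bound at \<open>t\<close> by compatibility. Only finitely many bounded sets enter, so it is finite; it is
  a supremum over a nonempty set because one common lower bound \<open>m\<close> of all upper bounds is added.
\<close>

lemma monotone_selection:
  fixes L U :: "'a \<Rightarrow> real set"
  assumes "finite I"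
    and refl: "\<And>t. t \<in> I \<Longrightarrow> le t t"
    and trans: "\<And>r s t. le r s \<Longrightarrow> le s t \<Longrightarrow> le r t"
    and L: "\<And>t. t \<in> I \<Longrightarrow> bdd_above (L t)"
    and U: "\<And>t. t \<in> I \<Longrightarrow> bdd_below (U t)"
    and compat: "\<And>s t l u. s \<in> I \<Longrightarrow> t \<in> I \<Longrightarrow> le s t \<Longrightarrow> l \<in> L s \<Longrightarrow> u \<in> U t \<Longrightarrow> l \<le> u"
  obtains f :: "'a \<Rightarrow> real" where
    "\<And>t l. t \<in> I \<Longrightarrow> l \<in> L t \<Longrightarrow> l \<le> f t"
    "\<And>t u. t \<in> I \<Longrightarrow> u \<in> U t \<Longrightarrow> f t \<le> u"
    "\<And>s t. le s t \<Longrightarrow> f s \<le> f t"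
proof -
  have "bdd_below (\<Union>t\<in>I. U t)"
    using \<open>finite I\<close> U by simp
  then obtain m where m: "\<And>t u. t \<in> I \<Longrightarrow> u \<in> U t \<Longrightarrow> m \<le> u"
    unfolding bdd_below_def by blast
  define D where "D t = insert m (\<Union>s\<in>{s \<in> I. le s t}. L s)" for t
  have bdd: "bdd_above (D t)" for t
    using \<open>finite I\<close> L by (simp add: D_def)
  show ?thesis
  proof (rule that[of "\<lambda>t. Sup (D t)"])
    show "l \<le> Sup (D t)" if "t \<in> I" "l \<in> L t" for t l
      using that refl by (intro cSup_upper bdd) (auto simp: D_def)
    show "Sup (D t) \<le> u" if "t \<in> I" "u \<in> U t" for t u
      using that m compat by (intro cSup_least) (auto simp: D_def)
    show "Sup (D s) \<le> Sup (D t)" if "le s t" for s t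
      using that trans by (intro cSup_subset_mono bdd) (auto simp: D_def)
  qed
qed

section \<open>Chords of a convex function\<close>

definition chord_slope :: "(real \<Rightarrow> real) \<Rightarrow> real \<Rightarrow> real \<Rightarrow> real" where
  "chord_slope f x y = (f y - f x) / (y - x)"

lemma convex_on_chord_bound:
  assumes f: "convex_on UNIV f" and "y \<noteq> x" and "0 \<le> h / (y - x)" and "h / (y - x) \<le> 1"
  shows "f (x + h) - f x \<le> h * chord_slope f x y"
proof -
  define \<theta> where "\<theta> = h / (y - x)"
  have h: "h = \<theta> * (y - x)" using \<open>y \<noteq> x\<close> by (simp add: \<theta>_def)
  have "f ((1 - \<theta>) *\<^sub>R x + \<theta> *\<^sub>R y) \<le> (1 - \<theta>) * f x + \<theta> * f y"
    using assms by (intro convex_onD[OF f]) (auto simp: \<theta>_def)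
  moreover have "(1 - \<theta>) *\<^sub>R x + \<theta> *\<^sub>R y = x + h"
    by (simp add: h algebra_simps)
  moreover have "h * chord_slope f x y = \<theta> * (f y - f x)"
    using \<open>y \<noteq> x\<close> by (simp add: h chord_slope_def)
  ultimately show ?thesis by (simp add: algebra_simps)
qed

lemma convex_on_chord_slope_le:
  assumes f: "convex_on UNIV f" and "y < x" and "x < z"
  shows "chord_slope f x y \<le> chord_slope f x z"
proof -
  have "(f y - f x) / (y - x) \<le> (f x - f z) / (x - z)"
    using convex_on_slope_le[OF f _ _ \<open>y < x\<close> \<open>x < z\<close>] by (auto intro: order_trans)
  also have "\<dots> = (f z - f x) / (z - x)"
    by (metis minus_diff_eq minus_divide_divide)
  finally show ?thesis by (simp add: chord_slope_def)
qed

lemma is_arg_min_tilted_if_chord_slopes: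
  assumes "x \<in> X"
    and left: "\<And>y. y \<in> X \<Longrightarrow> y < x \<Longrightarrow> chord_slope f x y \<le> m"
    and right: "\<And>y. y \<in> X \<Longrightarrow> x < y \<Longrightarrow> m \<le> chord_slope f x y"
  shows "is_arg_min (\<lambda>y. f y - m * y) (\<lambda>y. y \<in> X) x"
  unfolding is_arg_min_linorder
proof (intro conjI allI impI)
  fix y assume "y \<in> X"
  have split: "f y - f x = chord_slope f x y * (y - x)" if "y \<noteq> x"
    using that by (simp add: chord_slope_def)
  consider "y < x" | "y = x" | "x < y" by linarith
  then have "m * (y - x) \<le> f y - f x"
  proof cases
    case 1
    then show ?thesis using split left[OF \<open>y \<in> X\<close>] by (simp add: mult_right_mono_neg)
  next
    case 3
    then show ?thesis using split right[OF \<open>y \<in> X\<close>] by (simp add: mult_right_mono)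
  qed simp
  then show "f x - m * x \<le> f y - m * y" by (simp add: algebra_simps)
qed fact

section \<open>Shifting input between two times\<close>

text \<open>
  The order in which condition (iii) forces the scaled multipliers \<open>\<rho>\<^sup>t \<mu>\<^sub>t\<close>: \<open>price_order E S s t\<close>
  holds when (iii) implies \<open>\<rho>\<^sup>s \<mu>\<^sub>s \<le> \<rho>\<^sup>t \<mu>\<^sub>t\<close>. One of the two conjuncts is always vacuous.
\<close>

definition price_order :: "real \<Rightarrow> (nat \<Rightarrow> real) \<Rightarrow> nat \<Rightarrow> nat \<Rightarrow> bool" where
  "price_order E S s t \<longleftrightarrow>
     (\<forall>u. s \<le> u \<and> u < t \<longrightarrow> 0 < S u) \<and> (\<forall>u. t \<le> u \<and> u < s \<longrightarrow> S u < E)"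

lemma price_order_refl: "price_order E S t t"
  by (auto simp: price_order_def)

lemma price_order_trans: "price_order E S r s \<Longrightarrow> price_order E S s t \<Longrightarrow> price_order E S r t"
  unfolding price_order_def by (meson not_le)

text \<open>
  The path on which \<open>\<epsilon> * \<rho> ^ s\<close> less is put in at time \<open>s\<close> and \<open>\<epsilon> * \<rho> ^ t\<close> more at time \<open>t\<close>. With leakage
  \<open>\<rho>\<close> these two amounts have the same effect on all later levels, so only the levels between \<open>s\<close> and \<open>t\<close>
  change.
\<close>

definition shift_input :: "real \<Rightarrow> nat \<Rightarrow> nat \<Rightarrow> real \<Rightarrow> (nat \<Rightarrow> real) \<Rightarrow> nat \<Rightarrow> real" where
  "shift_input \<rho> s t \<epsilon> S u = S u + \<epsilon> * \<rho> ^ u * (of_bool (t \<le> u) - of_bool (s \<le> u))"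

lemma increment_shift_input:
  assumes "1 \<le> u"
  shows "increment \<rho> (shift_input \<rho> s t \<epsilon> S) u =
    increment \<rho> S u + \<epsilon> * \<rho> ^ u * (of_bool (u = t) - of_bool (u = s))"
proof -
  obtain v where u: "u = Suc v" using assms by (cases u) auto
  have step: "of_bool (r \<le> Suc v) = of_bool (r \<le> v) + (of_bool (Suc v = r) :: real)" for r
    by auto
  show ?thesis
    unfolding u increment_def shift_input_def step by (simp add: algebra_simps)
qed

text \<open>
  The points \<open>y\<close> and \<open>z\<close> witness that \<open>X\<close> leaves room for a smaller input at time \<open>s\<close> and a larger one
  at time \<open>t\<close>; the order of \<open>s\<close> and \<open>t\<close> gives the room for the levels in between. These are
  finitely many strict inequalities, so they survive a small enough shift.
\<close>

lemma feasible_shift_input: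
  assumes "0 < \<rho>"
    and feas: "feasible T E P_in P_out \<rho> S_init S_final S"
    and s: "1 \<le> s" "s \<le> T" and t: "1 \<le> t" "t \<le> T" and "s \<noteq> t"
    and ord: "price_order E S s t"
    and y: "y \<in> rate_set P_in P_out" "y < increment \<rho> S s"
    and z: "z \<in> rate_set P_in P_out" "increment \<rho> S t < z"
  shows "\<forall>\<^sub>F \<epsilon> in at_right 0. feasible T E P_in P_out \<rho> S_init S_final (shift_input \<rho> s t \<epsilon> S) \<and>
    y \<le> increment \<rho> S s - \<epsilon> * \<rho> ^ s \<and> increment \<rho> S t + \<epsilon> * \<rho> ^ t \<le> z"
proof -
  have lim: "((\<lambda>\<epsilon>. a + \<epsilon> * b * c) \<longlongrightarrow> a) (at_right 0)" for a b c :: real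
    by (auto intro!: tendsto_eq_intros)
  have cap: "\<forall>\<^sub>F \<epsilon> in at_right 0. 0 \<le> shift_input \<rho> s t \<epsilon> S u \<and> shift_input \<rho> s t \<epsilon> S u \<le> E"
    if u: "u \<in> {1..T - 1}" for u
  proof -
    have bounds: "0 \<le> S u" "S u \<le> E"
      using feas u by (auto simp: feasible_def capacity_constraints_def)
    have lim_u: "((\<lambda>\<epsilon>. shift_input \<rho> s t \<epsilon> S u) \<longlongrightarrow> S u) (at_right 0)"
      unfolding shift_input_def by (rule lim)
    have pos: "\<forall>\<^sub>F \<epsilon> in at_right 0. 0 \<le> \<epsilon> * \<rho> ^ u"
      using eventually_at_right_less[of 0] by eventually_elim (use \<open>0 < \<rho>\<close> in simp)
    consider "t \<le> u" "u < s" | "s \<le> u" "u < t" | "(t \<le> u) = (s \<le> u)" by linarith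
    then show ?thesis
    proof cases
      case 1
      then have "S u < E" using ord by (auto simp: price_order_def)
      from order_tendstoD(2)[OF lim_u this] pos show ?thesis
        by eventually_elim (use 1 bounds in \<open>auto simp: shift_input_def\<close>)
    next
      case 2
      then have "0 < S u" using ord by (auto simp: price_order_def)
      from order_tendstoD(1)[OF lim_u this] pos show ?thesis
        by eventually_elim (use 2 bounds in \<open>auto simp: shift_input_def\<close>)
    next
      case 3
      then show ?thesis using bounds by (simp add: shift_input_def)
    qed
  qed
  have "\<forall>\<^sub>F \<epsilon> in at_right 0. \<forall>u\<in>{1..T - 1}. 0 \<le> shift_input \<rho> s t \<epsilon> S u \<and> shift_input \<rho> s t \<epsilon> S u \<le> E"
    using cap by (simp add: eventually_ball_finite)
  moreover have "\<forall>\<^sub>F \<epsilon> in at_right 0. y < increment \<rho> S s + \<epsilon> * \<rho> ^ s * (-1)"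
    using lim y(2) by (rule order_tendstoD)
  moreover have "\<forall>\<^sub>F \<epsilon> in at_right 0. increment \<rho> S t + \<epsilon> * \<rho> ^ t * 1 < z"
    using lim z(2) by (rule order_tendstoD)
  ultimately show ?thesis
    using eventually_at_right_less[of 0]
  proof eventually_elim
    case (elim \<epsilon>)
    let ?S = "shift_input \<rho> s t \<epsilon> S"
    have "capacity_constraints T E S_init S_final ?S"
      using feas elim(1) s t
      by (auto simp: feasible_def capacity_constraints_def shift_input_def)
    moreover have "increment \<rho> ?S u \<in> rate_set P_in P_out" if u: "1 \<le> u" "u \<le> T" for u
    proof -
      have "increment \<rho> S u \<in> rate_set P_in P_out"
        using feas u by (simp add: feasible_def rate_constraints_def)
      moreover have "0 < \<epsilon> * \<rho> ^ u" using elim(4) \<open>0 < \<rho>\<close> by simp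
      ultimately show ?thesis
        using elim(2,3) y z \<open>s \<noteq> t\<close>
        by (auto simp: increment_shift_input[OF u(1)] rate_set_def)
    qed
    ultimately show ?case
      using elim(2,3) by (simp add: feasible_def rate_constraints_def)
  qed
qed

lemma total_cost_shift_input:
  assumes s: "s \<in> {1..T}" and t: "t \<in> {1..T}" and "s \<noteq> t"
  shows "total_cost T \<rho> C (shift_input \<rho> s t \<epsilon> S) - total_cost T \<rho> C S =
    (C s (increment \<rho> S s - \<epsilon> * \<rho> ^ s) - C s (increment \<rho> S s)) +
    (C t (increment \<rho> S t + \<epsilon> * \<rho> ^ t) - C t (increment \<rho> S t))"
proof -
  let ?\<Delta> = "\<lambda>u. C u (increment \<rho> (shift_input \<rho> s t \<epsilon> S) u) - C u (increment \<rho> S u)"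
  have "total_cost T \<rho> C (shift_input \<rho> s t \<epsilon> S) - total_cost T \<rho> C S = (\<Sum>u\<in>{1..T}. ?\<Delta> u)"
    by (simp add: total_cost_def sum_subtractf)
  also have "\<dots> = (\<Sum>u\<in>{s, t}. ?\<Delta> u)"
    using s t by (intro sum.mono_neutral_right) (auto simp: increment_shift_input)
  finally show ?thesis
    using s t \<open>s \<noteq> t\<close> by (simp add: increment_shift_input)
qed

text \<open>
  The shift of a small amount from \<open>s\<close> to \<open>t\<close> changes the cost by at most \<open>\<epsilon>\<close> times the difference of
  the two scaled slopes, by convexity, and by a nonnegative amount, by optimality. For \<open>s = t\<close> the
  shift does nothing, and the claim is that chord slopes of a convex function increase.
\<close>

lemma left_chord_le_right_chord:
  assumes "0 < \<rho>"
    and opt: "solves_P T E P_in P_out \<rho> S_init S_final C S"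
    and convex: "\<And>t. 1 \<le> t \<Longrightarrow> t \<le> T \<Longrightarrow> convex_on UNIV (C t)"
    and s: "1 \<le> s" "s \<le> T" and t: "1 \<le> t" "t \<le> T"
    and ord: "price_order E S s t"
    and y: "y \<in> rate_set P_in P_out" "y < increment \<rho> S s"
    and z: "z \<in> rate_set P_in P_out" "increment \<rho> S t < z"
  shows "\<rho> ^ s * chord_slope (C s) (increment \<rho> S s) y \<le> \<rho> ^ t * chord_slope (C t) (increment \<rho> S t) z"
    (is "_ * ?l \<le> _ * ?r")
proof (cases "s = t")
  case True
  then show ?thesis
    using convex_on_chord_slope_le[OF convex[OF s] y(2)] z(2) \<open>0 < \<rho>\<close>
    by (simp add: mult_left_mono)
next
  case False
  let ?S = "\<lambda>\<epsilon>. shift_input \<rho> s t \<epsilon> S"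
  have feas: "feasible T E P_in P_out \<rho> S_init S_final S"
    and min: "\<And>S'. feasible T E P_in P_out \<rho> S_init S_final S' \<Longrightarrow> total_cost T \<rho> C S \<le> total_cost T \<rho> C S'"
    using opt by (auto simp: solves_P_def is_arg_min_linorder)
  have "\<forall>\<^sub>F \<epsilon> in at_right 0. 0 < \<epsilon> \<and> feasible T E P_in P_out \<rho> S_init S_final (?S \<epsilon>) \<and>
    y \<le> increment \<rho> S s - \<epsilon> * \<rho> ^ s \<and> increment \<rho> S t + \<epsilon> * \<rho> ^ t \<le> z"
    using eventually_at_right_less[of 0]
      feasible_shift_input[OF \<open>0 < \<rho>\<close> feas s t False ord y z] by eventually_elim simp
  then obtain \<epsilon> where "0 < \<epsilon>" and feas': "feasible T E P_in P_out \<rho> S_init S_final (?S \<epsilon>)"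
    and room: "y \<le> increment \<rho> S s - \<epsilon> * \<rho> ^ s" "increment \<rho> S t + \<epsilon> * \<rho> ^ t \<le> z"
    using eventually_happens'[OF trivial_limit_at_right_real] by blast
  have pos: "0 < \<epsilon> * \<rho> ^ s" "0 < \<epsilon> * \<rho> ^ t" using \<open>0 < \<epsilon>\<close> \<open>0 < \<rho>\<close> by auto
  have "C s (increment \<rho> S s + - (\<epsilon> * \<rho> ^ s)) - C s (increment \<rho> S s) \<le> - (\<epsilon> * \<rho> ^ s) * ?l"
    using y(2) room(1) pos(1) by (intro convex_on_chord_bound convex s) (auto simp: field_simps)
  moreover have "C t (increment \<rho> S t + \<epsilon> * \<rho> ^ t) - C t (increment \<rho> S t) \<le> (\<epsilon> * \<rho> ^ t) * ?r"
    using z(2) room(2) pos(2) by (intro convex_on_chord_bound convex t) (auto simp: field_simps)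
  moreover have "0 \<le> total_cost T \<rho> C (?S \<epsilon>) - total_cost T \<rho> C S"
    using min[OF feas'] by simp
  ultimately have "0 \<le> - (\<epsilon> * \<rho> ^ s) * ?l + (\<epsilon> * \<rho> ^ t) * ?r"
    using total_cost_shift_input[of s T t \<rho> C \<epsilon> S] s t False by simp
  then have "\<epsilon> * (\<rho> ^ s * ?l) \<le> \<epsilon> * (\<rho> ^ t * ?r)" by (simp add: algebra_simps)
  then show ?thesis using \<open>0 < \<epsilon>\<close> by simp
qed

section \<open>Optimal store paths and their multipliers\<close>

theorem theorem2:
  fixes T :: nat
    and E P_in P_out \<rho> S_init S_final :: real
    and C :: "nat \<Rightarrow> real \<Rightarrow> real"
  assumes "T \<ge> 1"
    and "E > 0" and "P_in > 0" and "P_out > 0"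
    and "0 < \<rho>" and "\<rho> \<le> 1"
    and "\<exists>S. feasible T E P_in P_out \<rho> S_init S_final S"
    and "\<And>t. 1 \<le> t \<Longrightarrow> t \<le> T \<Longrightarrow> convex_on UNIV (C t)"
  shows "\<exists>(S :: nat \<Rightarrow> real) (\<mu> :: nat \<Rightarrow> real).
    solves_P T E P_in P_out \<rho> S_init S_final C S \<and>
    feasible T E P_in P_out \<rho> S_init S_final S \<and>
    (\<forall>t. 1 \<le> t \<and> t \<le> T \<longrightarrow>
       is_arg_min (\<lambda>x. C t x - \<mu> t * x) (\<lambda>x. x \<in> rate_set P_in P_out) (increment \<rho> S t)) \<and>
    (\<forall>t. 1 \<le> t \<and> t \<le> T - 1 \<longrightarrow>
       (0 < S t \<and> S t < E \<longrightarrow> \<rho> * \<mu> (t + 1) = \<mu> t) \<and>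
       (S t = 0 \<longrightarrow> \<rho> * \<mu> (t + 1) \<le> \<mu> t) \<and>
       (S t = E \<longrightarrow> \<rho> * \<mu> (t + 1) \<ge> \<mu> t))"
proof -
  let ?X = "rate_set P_in P_out"
  have convex: "\<And>t. 1 \<le> t \<Longrightarrow> t \<le> T \<Longrightarrow> convex_on UNIV (C t)" by fact
  have cont: "continuous_on UNIV (C t)" if "1 \<le> t" "t \<le> T" for t
    using convex_on_continuous[OF open_UNIV convex] that by blast
  obtain S where opt: "solves_P T E P_in P_out \<rho> S_init S_final C S"
    using solves_P_exists[where C = C, OF \<open>T \<ge> 1\<close> \<open>\<exists>S. feasible T E P_in P_out \<rho> S_init S_final S\<close> cont]
    by blast
  then have feas: "feasible T E P_in P_out \<rho> S_init S_final S"
    by (simp add: solves_P_def is_arg_min_def)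
  let ?x = "increment \<rho> S"
  let ?slope = "\<lambda>t. chord_slope (C t) (?x t)"
  define L where "L t = (\<lambda>y. \<rho> ^ t * ?slope t y) ` {y \<in> ?X. y < ?x t}" for t
  define U where "U t = (\<lambda>z. \<rho> ^ t * ?slope t z) ` {z \<in> ?X. ?x t < z}" for t
  \<comment> \<open>The chords to \<open>x\<^sub>t + 1\<close> and \<open>x\<^sub>t - 1\<close> bound the slopes even where these points leave \<open>X\<close>.\<close>
  have bdd_L: "bdd_above (L t)" if "t \<in> {1..T}" for t
  proof (rule bdd_aboveI)
    fix l assume "l \<in> L t"
    then show "l \<le> \<rho> ^ t * ?slope t (?x t + 1)"
      using that \<open>0 < \<rho>\<close> by (auto simp: L_def intro!: convex_on_chord_slope_le convex)
  qed
  have bdd_U: "bdd_below (U t)" if "t \<in> {1..T}" for t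
  proof (rule bdd_belowI)
    fix u assume "u \<in> U t"
    then show "\<rho> ^ t * ?slope t (?x t - 1) \<le> u"
      using that \<open>0 < \<rho>\<close> by (auto simp: U_def intro!: convex_on_chord_slope_le convex)
  qed
  have compat: "l \<le> u" if "s \<in> {1..T}" "t \<in> {1..T}" "price_order E S s t" "l \<in> L s" "u \<in> U t" for s t l u
    using that left_chord_le_right_chord[OF \<open>0 < \<rho>\<close> opt convex] by (auto simp: L_def U_def)
  obtain p :: "nat \<Rightarrow> real" where lower: "\<And>t l. t \<in> {1..T} \<Longrightarrow> l \<in> L t \<Longrightarrow> l \<le> p t"
    and upper: "\<And>t u. t \<in> {1..T} \<Longrightarrow> u \<in> U t \<Longrightarrow> p t \<le> u"
    and mono: "\<And>s t. price_order E S s t \<Longrightarrow> p s \<le> p t"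
    by (rule monotone_selection[of "{1..T}" "price_order E S" L U,
          OF finite_atLeastAtMost price_order_refl price_order_trans bdd_L bdd_U compat]) blast+
  define \<mu> where "\<mu> t = p t / \<rho> ^ t" for t
  have \<mu>: "\<rho> ^ t * \<mu> t = p t" for t
    using \<open>0 < \<rho>\<close> by (simp add: \<mu>_def)
  have "is_arg_min (\<lambda>x. C t x - \<mu> t * x) (\<lambda>x. x \<in> ?X) (?x t)" if t: "1 \<le> t" "t \<le> T" for t
  proof (rule is_arg_min_tilted_if_chord_slopes)
    show "?x t \<in> ?X"
      using feas t by (simp add: feasible_def rate_constraints_def)
    show "?slope t y \<le> \<mu> t" if "y \<in> ?X" "y < ?x t" for y
    proof -
      have "\<rho> ^ t * ?slope t y \<le> \<rho> ^ t * \<mu> t"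
        unfolding \<mu> using that t by (intro lower) (auto simp: L_def)
      then show ?thesis using \<open>0 < \<rho>\<close> by simp
    qed
    show "\<mu> t \<le> ?slope t y" if "y \<in> ?X" "?x t < y" for y
    proof -
      have "\<rho> ^ t * \<mu> t \<le> \<rho> ^ t * ?slope t y"
        unfolding \<mu> using that t by (intro upper) (auto simp: U_def)
      then show ?thesis using \<open>0 < \<rho>\<close> by simp
    qed
  qed
  moreover have "\<mu> t \<le> \<rho> * \<mu> (t + 1)" if "0 < S t" for t
  proof -
    have "price_order E S t (t + 1)"
      using that by (auto simp: price_order_def less_Suc_eq)
    then have "\<rho> ^ t * \<mu> t \<le> \<rho> ^ t * (\<rho> * \<mu> (t + 1))"
      using mono \<mu>[of t] \<mu>[of "t + 1"] by (simp add: mult_ac)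
    then show ?thesis using \<open>0 < \<rho>\<close> by simp
  qed
  moreover have "\<rho> * \<mu> (t + 1) \<le> \<mu> t" if "S t < E" for t
  proof -
    have "price_order E S (t + 1) t"
      using that by (auto simp: price_order_def less_Suc_eq)
    then have "\<rho> ^ t * (\<rho> * \<mu> (t + 1)) \<le> \<rho> ^ t * \<mu> t"
      using mono \<mu>[of t] \<mu>[of "t + 1"] by (simp add: mult_ac)
    then show ?thesis using \<open>0 < \<rho>\<close> by simp
  qed
  ultimately show ?thesis
    using opt feas \<open>0 < E\<close> by (intro exI[of _ S] exI[of _ \<mu>]) (auto intro: order_antisym)
qed

end
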